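(* Let $p_1(t),\ldots,p_n(t)\in \mathbb{K}[t,t^{-1}]$ be linearly independent over $\mathbb{K}$. Then the Wronskian $W(p_1,\ldots,p_n)$ is a nonzero constant if and only if there exist a nonsingular $n\times n$ matrix $A$ with entries in $\mathbb{K}$ and integers $r_1,\ldots,r_n\in\mathbb{Z}$, all distinct, satisfying $$r_1+\cdots+r_n=\binom{n}{2},$$ such that $$\begin{bmatrix} p_1(t)\\ p_2(t)\\ \vdots\\ p_n(t)\end{bmatrix}=A\cdot\begin{bmatrix}t^{r_1}\\ t^{r_2}\\ \vdots\\ t^{r_n}\end{bmatrix}.$$
   Context: $\mathbb{K}$ is a field of characteristic zero, $n$ is a positive integer, and $\mathbb{K}[t,t^{-1}]$ is the ring of Laurent polynomials in $t$ over $\mathbb{K}$, with the usual derivative ($(t^r)'=r t^{r-1}$ for $r\in\mathbb{Z}$). The Wronskian $W(p_1,\ldots,p_n)$ is the determinant of the $n\times n$ matrix whose entry in row $k$ and column $j$ is the $(k-1)$-th derivative $p_j^{(k-1)}(t)$; it is an element of $\mathbb{K}[t,t^{-1}]$. "Nonzero constant" means a nonzero element of $\mathbb{K}$. *)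

theory Defs
  imports
    "HOL-Computational_Algebra.Formal_Laurent_Series"
    "Jordan_Normal_Form.Determinant"
begin

text \<open>
  The ring of Laurent polynomials in \<open>t\<close> over \<open>'a\<close>, as the subring of finitely supported formal
  Laurent series. Here \<open>t ^ r\<close> is \<open>fls_X_intpow r\<close> (an abbreviation for \<open>fls_shift (- r) 1\<close>),
  scalars are embedded by \<open>fls_const\<close>, and the derivative is \<open>fls_deriv\<close>.
\<close>

definition laurent_polys :: "'a::zero fls set" where
  "laurent_polys = {f. finite {i. fls_nth f i \<noteq> 0}}"

text \<open>
  Families of length \<open>n\<close> are indexed by \<open>0, \<dots>, n - 1\<close>; the values of \<open>p\<close> at other indices are
  irrelevant.
\<close>

definition lin_indep_family :: "nat \<Rightarrow> (nat \<Rightarrow> 'a::field fls) \<Rightarrow> bool" where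
  "lin_indep_family n p \<longleftrightarrow>
     (\<forall>c :: nat \<Rightarrow> 'a. (\<Sum>j<n. fls_const (c j) * p j) = 0 \<longrightarrow> (\<forall>j<n. c j = 0))"

definition wronskian :: "nat \<Rightarrow> (nat \<Rightarrow> 'a::comm_ring_1 fls) \<Rightarrow> 'a fls" where
  "wronskian n p = det (mat n n (\<lambda>(k, j). (fls_deriv ^^ k) (p j)))"

lemma fls_X_intpow_in_laurent_polys: "(fls_X_intpow r :: 'a::zero_neq_one fls) \<in> laurent_polys"
proof -
  have "{i. fls_nth (fls_X_intpow r :: 'a fls) i \<noteq> 0} \<subseteq> {r}"
    by auto
  then show ?thesis
    unfolding laurent_polys_def by (simp add: finite_subset)
qed

lemma fls_deriv_X_intpow:
  "fls_deriv (fls_X_intpow r :: 'a::comm_ring_1 fls) = of_int r * fls_X_intpow (r - 1)"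
proof (rule fls_eqI)
  fix i :: int
  have coeff_eq: "of_int i + 1 = (of_int r :: 'a)" if "i + (1 - r) = 0"
  proof -
    from that have "r = i + 1" by simp
    then show ?thesis by simp
  qed
  then show "fls_nth (fls_deriv (fls_X_intpow r :: 'a fls)) i
      = fls_nth (of_int r * fls_X_intpow (r - 1)) i"
    using coeff_eq by (auto simp: fls_of_int)
qed

end

theory Submission
  imports Defs
begin

text \<open>
  For a family \<open>b\<close> of nonzero Laurent polynomials write \<open>l\<^sub>j\<close> and \<open>h\<^sub>j\<close> for the least and the greatest
  exponent occurring in \<open>b\<^sub>j\<close>. In the Leibniz expansion of the Wronskian, the exponents of every term
  lie between \<open>\<Sum> l\<^sub>j - binom(n, 2)\<close> and \<open>\<Sum> h\<^sub>j - binom(n, 2)\<close>. The coefficient at the lower bound is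
  the product of the coefficients of the \<open>b\<^sub>j\<close> at \<open>l\<^sub>j\<close> with the determinant of the falling factorials
  \<open>l\<^sub>j (l\<^sub>j - 1) \<dots> (l\<^sub>j - k + 1)\<close>, a Vandermonde determinant up to row operations. In characteristic
  zero it is therefore nonzero as soon as the \<open>l\<^sub>j\<close> are distinct, and likewise at the upper bound for
  distinct \<open>h\<^sub>j\<close> (\<open>wronskian_edge\<close>). For monomials \<open>t ^ r\<^sub>j\<close> both bounds equal \<open>\<Sum> r\<^sub>j - binom(n, 2)\<close>,
  so distinct \<open>r\<^sub>j\<close> with sum \<open>binom(n, 2)\<close> give a nonzero constant; a change of basis only multiplies
  the Wronskian by a scalar determinant. This is the direction from right to left.

  For the converse, express \<open>p\<close> by a family \<open>b\<close> of Laurent polynomials whose total width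
  \<open>\<Sum> (h\<^sub>j - l\<^sub>j)\<close> is as small as possible. If two members had the same least or the same greatest
  exponent, subtracting a multiple of one from the other would shrink the total width. Hence the
  \<open>l\<^sub>j\<close> are distinct and the \<open>h\<^sub>j\<close> are distinct (\<open>ex_reduced_family\<close>). The Wronskian of \<open>b\<close> is constant
  too, but has nonzero coefficients at both bounds, so
  \<open>\<Sum> l\<^sub>j = binom(n, 2) = \<Sum> h\<^sub>j\<close>. As \<open>l\<^sub>j \<le> h\<^sub>j\<close>, each \<open>b\<^sub>j\<close> has a single exponent: it is a multiple
  of a monomial. The transition matrix is nonsingular because its determinant divides the nonzero
  Wronskian of \<open>p\<close>.
\<close>

section \<open>Extreme coefficients of Laurent series\<close>

text \<open>
  The sign of \<open>s\<close> selects the end: for \<open>s > 0\<close> the number \<open>a\<close> is a lower bound for the exponents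
  in \<open>f\<close>, for \<open>s < 0\<close> an upper bound. Both ends of a Wronskian can thus be treated at once.
\<close>

definition supported_from :: "int \<Rightarrow> int \<Rightarrow> 'a::zero fls \<Rightarrow> bool" where
  "supported_from s a f \<longleftrightarrow> (\<forall>i. fls_nth f i \<noteq> 0 \<longrightarrow> s * a \<le> s * i)"

lemma fls_nth_times_single:
  fixes f g :: "'a::comm_ring_1 fls"
  assumes "\<And>i. fls_nth f i \<noteq> 0 \<Longrightarrow> fls_nth g (n - i) \<noteq> 0 \<Longrightarrow> i = a"
  shows "fls_nth (f * g) n = fls_nth f a * fls_nth g (n - a)"
proof -
  let ?I = "{fls_subdegree f..n - fls_subdegree g}"
  have "fls_nth (f * g) n = (\<Sum>i\<in>?I. fls_nth f i * fls_nth g (n - i))"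
    by (rule fls_times_nth(2))
  also have "\<dots> = (\<Sum>i\<in>?I. if i = a then fls_nth f a * fls_nth g (n - a) else 0)"
    using assms by (intro sum.cong) force+
  also have "\<dots> = (if a \<in> ?I then fls_nth f a * fls_nth g (n - a) else 0)"
    by simp
  also have "\<dots> = fls_nth f a * fls_nth g (n - a)"
    by auto
  finally show ?thesis .
qed

lemma supported_from_times:
  fixes f g :: "'a::comm_ring_1 fls"
  assumes "supported_from s a f" "supported_from s b g"
  shows "supported_from s (a + b) (f * g)"
  unfolding supported_from_def
proof (intro allI impI)
  fix n assume "fls_nth (f * g) n \<noteq> 0"
  then obtain i where "fls_nth f i * fls_nth g (n - i) \<noteq> 0"
    unfolding fls_times_nth(2) by (meson sum.neutral)
  then have "fls_nth f i \<noteq> 0" "fls_nth g (n - i) \<noteq> 0"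
    by auto
  then have "s * a \<le> s * i" "s * b \<le> s * (n - i)"
    using assms unfolding supported_from_def by blast+
  then show "s * (a + b) \<le> s * n"
    by (simp add: algebra_simps)
qed

text \<open>
  When both factors end at \<open>a\<close> and \<open>b\<close>, only one pair of exponents can add up to \<open>a + b\<close>, so the
  convolution has a single term there.
\<close>

lemma edge_coeff_times:
  fixes f g :: "'a::comm_ring_1 fls"
  assumes "s \<noteq> 0" "supported_from s a f" "supported_from s b g"
  shows "fls_nth (f * g) (a + b) = fls_nth f a * fls_nth g b"
proof -
  have "i = a" if "fls_nth f i \<noteq> 0" "fls_nth g (a + b - i) \<noteq> 0" for i
  proof -
    have "s * a \<le> s * i" "s * b \<le> s * (a + b - i)"
      using that assms unfolding supported_from_def by blast+
    then have "s * a = s * i"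
      by (intro antisym) (simp_all add: algebra_simps)
    with \<open>s \<noteq> 0\<close> show ?thesis by simp
  qed
  then show ?thesis
    using fls_nth_times_single[of f g "a + b" a] by simp
qed

lemma edge_coeff_prod:
  fixes f :: "'b \<Rightarrow> 'a::comm_ring_1 fls"
  assumes "finite I" "s \<noteq> 0" "\<And>i. i \<in> I \<Longrightarrow> supported_from s (a i) (f i)"
  shows "supported_from s (\<Sum>i\<in>I. a i) (\<Prod>i\<in>I. f i)
    \<and> fls_nth (\<Prod>i\<in>I. f i) (\<Sum>i\<in>I. a i) = (\<Prod>i\<in>I. fls_nth (f i) (a i))"
  using assms(1,3)
proof (induction I rule: finite_induct)
  case empty
  then show ?case by (simp add: supported_from_def)
next
  case (insert x I)
  have x: "supported_from s (a x) (f x)"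
    using insert.prems by simp
  have I: "supported_from s (\<Sum>i\<in>I. a i) (\<Prod>i\<in>I. f i)"
    "fls_nth (\<Prod>i\<in>I. f i) (\<Sum>i\<in>I. a i) = (\<Prod>i\<in>I. fls_nth (f i) (a i))"
    using insert.IH insert.prems by simp_all
  show ?case
    using supported_from_times[OF x I(1)] edge_coeff_times[OF \<open>s \<noteq> 0\<close> x I(1)] I(2) insert.hyps
    by simp
qed

lemma fls_nth_of_int_times [simp]:
  "fls_nth (of_int m * f) i = of_int m * fls_nth (f :: 'a::comm_ring_1 fls) i"
  by (simp add: fls_of_int)

lemma fls_nth_sum: "fls_nth (sum f I) i = (\<Sum>x\<in>I. fls_nth (f x) i)"
  by (induction I rule: infinite_finite_induct) simp_all

text \<open>
  If the ends of the entries have the form \<open>c j - r i\<close>, then every term of the Leibniz formula ends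
  at the same exponent \<open>e\<close>, since a permutation does not change \<open>\<Sum> c\<close>. Taking the coefficient at \<open>e\<close>
  hence commutes with the determinant.
\<close>

lemma edge_coeff_det:
  fixes M :: "'a::comm_ring_1 fls mat"
  assumes M: "M \<in> carrier_mat n n" and "s \<noteq> 0"
    and supp: "\<And>i j. i < n \<Longrightarrow> j < n \<Longrightarrow> supported_from s (c j - r i) (M $$ (i, j))"
  defines "e \<equiv> (\<Sum>j<n. c j) - (\<Sum>i<n. r i)"
  shows "supported_from s e (det M)"
    and "fls_nth (det M) e = det (mat n n (\<lambda>(i, j). fls_nth (M $$ (i, j)) (c j - r i)))"
proof -
  have summand: "supported_from s e (\<Prod>i=0..<n. M $$ (i, \<pi> i))
      \<and> fls_nth (\<Prod>i=0..<n. M $$ (i, \<pi> i)) e = (\<Prod>i=0..<n. fls_nth (M $$ (i, \<pi> i)) (c (\<pi> i) - r i))"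
    if \<pi>: "\<pi> permutes {0..<n}" for \<pi>
  proof -
    have "(\<Sum>i=0..<n. c (\<pi> i) - r i) = e"
      using sum.permute[OF \<pi>, of c] by (simp add: e_def sum_subtractf o_def atLeast0LessThan)
    moreover have "\<pi> i < n" if "i < n" for i
      using \<pi> that permutes_in_image[OF \<pi>, of i] by simp
    ultimately show ?thesis
      using edge_coeff_prod[of "{0..<n}" s "\<lambda>i. c (\<pi> i) - r i" "\<lambda>i. M $$ (i, \<pi> i)"] supp \<open>s \<noteq> 0\<close>
      by simp
  qed
  show "supported_from s e (det M)"
    unfolding supported_from_def
  proof (intro allI impI)
    fix k assume "fls_nth (det M) k \<noteq> 0"
    then obtain \<pi> where \<pi>: "\<pi> permutes {0..<n}"
        "fls_nth (signof \<pi> * (\<Prod>i=0..<n. M $$ (i, \<pi> i))) k \<noteq> 0"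
      unfolding det_def'[OF M] fls_nth_sum by (smt (verit) mem_Collect_eq sum.neutral)
    then have "fls_nth (\<Prod>i=0..<n. M $$ (i, \<pi> i)) k \<noteq> 0"
      by auto
    then show "s * e \<le> s * k"
      using summand[OF \<pi>(1)] unfolding supported_from_def by blast
  qed
  have "fls_nth (det M) e
      = (\<Sum>\<pi> | \<pi> permutes {0..<n}. signof \<pi> * (\<Prod>i=0..<n. fls_nth (M $$ (i, \<pi> i)) (c (\<pi> i) - r i)))"
    unfolding det_def'[OF M] fls_nth_sum using summand by (intro sum.cong) auto
  also have "\<dots> = det (mat n n (\<lambda>(i, j). fls_nth (M $$ (i, j)) (c j - r i)))"
    by (subst det_def'[of _ n])
      (auto intro!: sum.cong prod.cong arg_cong2[where f = "(*)"] simp: permutes_in_image)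
  finally show "fls_nth (det M) e = det (mat n n (\<lambda>(i, j). fls_nth (M $$ (i, j)) (c j - r i)))" .
qed

section \<open>Extreme coefficients of a Wronskian\<close>

text \<open>
  The factor that \<open>k\<close> derivatives put in front of \<open>t ^ x\<close>, as a polynomial in \<open>x\<close>:
  \<open>x (x - 1) \<dots> (x - k + 1)\<close>.
\<close>

definition ffact_poly :: "nat \<Rightarrow> 'a::idom poly" where
  "ffact_poly k = (\<Prod>l<k. [:- of_nat l, 1:])"

lemma fls_nth_deriv_power:
  fixes f :: "'a::idom fls"
  shows "fls_nth ((fls_deriv ^^ k) f) (i - int k) = poly (ffact_poly k) (of_int i) * fls_nth f i"
proof (induction k arbitrary: i)
  case 0
  then show ?case by (simp add: ffact_poly_def)
next
  case (Suc k)
  have "i - int (Suc k) + 1 = i - int k"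
    by simp
  then have "fls_nth ((fls_deriv ^^ Suc k) f) (i - int (Suc k))
      = of_int (i - int k) * fls_nth ((fls_deriv ^^ k) f) (i - int k)"
    by (simp only: funpow.simps o_apply fls_deriv_nth)
  also have "\<dots> = of_int (i - int k) * (poly (ffact_poly k) (of_int i) * fls_nth f i)"
    by (simp only: Suc)
  finally show ?case
    by (simp add: ffact_poly_def poly_prod algebra_simps)
qed

lemma degree_ffact_poly: "Polynomial.degree (ffact_poly k :: 'a::idom poly) = k"
  by (simp add: ffact_poly_def degree_prod_eq_sum_degree)

text \<open>
  The polynomials have pairwise distinct degrees \<open>0, 1, 2, \<dots>\<close>, so the top coefficient of a vanishing
  combination forces \<open>v\<close> to vanish from the highest index downwards.
\<close>

lemma ffact_polys_independent:
  fixes v :: "nat \<Rightarrow> 'a::idom"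
  assumes "(\<Sum>k<n. Polynomial.smult (v k) (ffact_poly k)) = 0" "k < n"
  shows "v k = 0"
  using assms
proof (induction n)
  case (Suc n)
  have "Polynomial.degree (\<Sum>k<n. Polynomial.smult (v k) (ffact_poly k)) < n" if "n > 0"
    using that by (intro degree_sum_less) (auto simp: degree_ffact_poly)
  then have "Polynomial.coeff (\<Sum>k<n. Polynomial.smult (v k) (ffact_poly k)) n = 0"
    by (cases "n = 0") (auto intro: coeff_eq_0)
  moreover have "Polynomial.coeff (ffact_poly n :: 'a poly) n \<noteq> 0"
  proof -
    have "(ffact_poly n :: 'a poly) \<noteq> 0"
      by (simp add: ffact_poly_def)
    then show ?thesis
      by (metis degree_ffact_poly leading_coeff_0_iff)
  qed
  moreover have "Polynomial.coeff (\<Sum>k<Suc n. Polynomial.smult (v k) (ffact_poly k)) n = 0"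
    using Suc.prems(1) by simp
  ultimately have "v n = 0"
    by simp
  with Suc show ?case
    by (auto simp: less_Suc_eq)
qed simp

text \<open>
  The Vandermonde argument: a vector annihilated by the transpose holds the coefficients, with
  respect to the falling factorials, of a polynomial of degree below \<open>n\<close> that vanishes at the \<open>n\<close>
  distinct points \<open>x j\<close>.
\<close>

lemma det_ffact_nonzero:
  fixes x c :: "nat \<Rightarrow> 'a::idom"
  assumes inj: "inj_on x {..<n}" and c: "\<And>j. j < n \<Longrightarrow> c j \<noteq> 0"
  shows "det (mat n n (\<lambda>(k, j). poly (ffact_poly k) (x j) * c j)) \<noteq> 0"
proof
  let ?N = "mat n n (\<lambda>(k, j). poly (ffact_poly k) (x j) * c j)"
  assume "det ?N = 0"
  then have "det (transpose_mat ?N) = 0"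
    by (simp add: det_transpose[of _ n])
  then obtain v where v: "v \<in> carrier_vec n" "v \<noteq> 0\<^sub>v n" "transpose_mat ?N *\<^sub>v v = 0\<^sub>v n"
    using det_0_iff_vec_prod_zero[of "transpose_mat ?N" n] by auto
  define q where "q = (\<Sum>k<n. Polynomial.smult (v $ k) (ffact_poly k))"
  have root: "poly q (x j) = 0" if "j < n" for j
  proof -
    have "0 = (transpose_mat ?N *\<^sub>v v) $ j"
      using v(3) that by simp
    also have "\<dots> = (\<Sum>k<n. poly (ffact_poly k) (x j) * c j * v $ k)"
      using that v(1) by (auto simp: scalar_prod_def atLeast0LessThan)
    also have "\<dots> = c j * poly q (x j)"
      by (simp add: q_def poly_sum sum_distrib_left mult_ac)
    finally show ?thesis
      using c[OF that] by simp
  qed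
  have "q = 0"
  proof (rule ccontr)
    assume "q \<noteq> 0"
    then have "n > 0"
      by (cases n) (auto simp: q_def)
    then have "Polynomial.degree q < n"
      unfolding q_def by (intro degree_sum_less) (auto simp: degree_ffact_poly)
    moreover have "x ` {..<n} \<subseteq> {y. poly q y = 0}"
      using root by auto
    then have "card (x ` {..<n}) \<le> card {y. poly q y = 0}"
      using poly_roots_finite[OF \<open>q \<noteq> 0\<close>] by (rule card_mono[rotated])
    ultimately show False
      using card_poly_roots_bound[OF \<open>q \<noteq> 0\<close>] card_image[OF inj] by simp
  qed
  then have "v = 0\<^sub>v n"
    using ffact_polys_independent[of "\<lambda>k. v $ k" n] v(1) by (intro eq_vecI) (auto simp: q_def)
  with v(2) show False by simp
qed

lemma sum_lessThan_eq_choose_2: "(\<Sum>k<n. int k) = int (n choose 2)"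
  by (induction n) (simp_all add: numeral_2_eq_2)

text \<open>
  Each of the \<open>k\<close> derivatives in row \<open>k\<close> lowers exponents by one, so the rows together contribute
  \<open>0 + 1 + \<dots> + (n - 1) = binom(n, 2)\<close>. Characteristic zero keeps distinct exponents distinct as
  elements of the field, where the falling factorials are evaluated. With \<open>s = 1\<close> and \<open>s = -1\<close> this
  yields the lowest and the highest term of the Wronskian.
\<close>

lemma wronskian_edge:
  fixes b :: "nat \<Rightarrow> 'a::field_char_0 fls"
  assumes "s \<noteq> 0" and inj: "inj_on d {..<n}"
    and supp: "\<And>j. j < n \<Longrightarrow> supported_from s (d j) (b j)"
    and nz: "\<And>j. j < n \<Longrightarrow> fls_nth (b j) (d j) \<noteq> 0"
  defines "e \<equiv> (\<Sum>j<n. d j) - int (n choose 2)"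
  shows "supported_from s e (wronskian n b)" "fls_nth (wronskian n b) e \<noteq> 0"
proof -
  let ?M = "mat n n (\<lambda>(k, j). (fls_deriv ^^ k) (b j))"
  have supp': "supported_from s (d j - int k) (?M $$ (k, j))" if "k < n" "j < n" for k j
    unfolding supported_from_def
  proof (intro allI impI)
    fix i assume "fls_nth (?M $$ (k, j)) i \<noteq> 0"
    then have "fls_nth (b j) (i + int k) \<noteq> 0"
      using that fls_nth_deriv_power[of k "b j" "i + int k"] by auto
    then have "s * d j \<le> s * (i + int k)"
      using supp[OF \<open>j < n\<close>] unfolding supported_from_def by blast
    then show "s * (d j - int k) \<le> s * i"
      by (simp add: algebra_simps)
  qed
  have M: "?M \<in> carrier_mat n n" by simp
  note edge = edge_coeff_det[where c = d and r = int, OF M \<open>s \<noteq> 0\<close> supp',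
      unfolded sum_lessThan_eq_choose_2, folded e_def wronskian_def]
  show "supported_from s e (wronskian n b)"
    by (rule edge(1))
  have "mat n n (\<lambda>(k, j). fls_nth (?M $$ (k, j)) (d j - int k))
      = mat n n (\<lambda>(k, j). poly (ffact_poly k) (of_int (d j)) * fls_nth (b j) (d j))"
    by (rule eq_matI) (auto simp: fls_nth_deriv_power)
  moreover have "inj_on (\<lambda>j. of_int (d j) :: 'a) {..<n}"
    using inj by (simp add: inj_on_def)
  ultimately show "fls_nth (wronskian n b) e \<noteq> 0"
    using edge(2) det_ffact_nonzero[of "\<lambda>j. of_int (d j)" n "\<lambda>j. fls_nth (b j) (d j)"] nz by simp
qed

section \<open>Change of basis\<close>

text \<open>
  The coefficients form a plain function rather than a matrix so that one entry at a time can be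
  updated when a member of \<open>b\<close> is replaced.
\<close>

definition expressed_by :: "nat \<Rightarrow> (nat \<Rightarrow> nat \<Rightarrow> 'a) \<Rightarrow> (nat \<Rightarrow> 'a::comm_ring_1 fls) \<Rightarrow> (nat \<Rightarrow> 'a fls) \<Rightarrow> bool" where
  "expressed_by n a b p \<longleftrightarrow> (\<forall>i<n. p i = (\<Sum>j<n. fls_const (a i j) * b j))"

lemma vec_eq_mult_mat_iff_expressed_by:
  assumes "A \<in> carrier_mat n n"
  shows "vec n p = map_mat fls_const A *\<^sub>v vec n b \<longleftrightarrow> expressed_by n (\<lambda>i j. A $$ (i, j)) b p"
proof -
  have "(map_mat fls_const A *\<^sub>v vec n b) $ i = (\<Sum>j<n. fls_const (A $$ (i, j)) * b j)" if "i < n" for i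
    using that assms by (auto simp: scalar_prod_def atLeast0LessThan intro!: sum.cong)
  then show ?thesis
    using assms by (auto simp: expressed_by_def vec_eq_iff)
qed

lemma fls_deriv_power_sum:
  fixes b :: "'b \<Rightarrow> 'a::comm_ring_1 fls"
  shows "(fls_deriv ^^ k) (\<Sum>j\<in>J. fls_const (c j) * b j) = (\<Sum>j\<in>J. fls_const (c j) * (fls_deriv ^^ k) (b j))"
  by (induction k) (simp_all add: fls_deriv_sum)

lemma wronskian_expressed_by:
  fixes b :: "nat \<Rightarrow> 'a::comm_ring_1 fls"
  assumes "expressed_by n a b p"
  shows "wronskian n p = fls_const (det (mat n n (\<lambda>(i, j). a i j))) * wronskian n b"
proof -
  interpret comm_ring_hom "fls_const :: 'a \<Rightarrow> 'a fls"
    by unfold_locales (simp_all add: fls_plus_const)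
  let ?A = "mat n n (\<lambda>(i, j). a i j)"
  let ?B = "mat n n (\<lambda>(k, j). (fls_deriv ^^ k) (b j))"
  have "mat n n (\<lambda>(k, j). (fls_deriv ^^ k) (p j)) = ?B * transpose_mat (map_mat fls_const ?A)"
    using assms
    by (intro eq_matI)
      (auto simp: expressed_by_def fls_deriv_power_sum scalar_prod_def atLeast0LessThan
        mult.commute[of "(fls_deriv ^^ _) _"] intro!: sum.cong)
  then show ?thesis
    unfolding wronskian_def
    by (simp add: det_mult[of _ n] det_transpose[of _ n] mult.commute)
qed

text \<open>
  Substituting \<open>b i = (b i - c b j) + c b j\<close> moves \<open>c\<close> times the \<open>i\<close>-th column of the coefficients
  into the \<open>j\<close>-th.
\<close>

lemma expressed_by_update:
  fixes b :: "nat \<Rightarrow> 'a::comm_ring_1 fls"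
  assumes "expressed_by n a b p" and ij: "i < n" "j < n" "i \<noteq> j"
  shows "expressed_by n (\<lambda>k. (a k)(j := a k j + a k i * c)) (b(i := b i - fls_const c * b j)) p"
  unfolding expressed_by_def
proof (intro allI impI)
  fix k assume "k < n"
  let ?R = "{..<n} - {i, j}"
  have split: "(\<Sum>l<n. g l) = g i + g j + (\<Sum>l\<in>?R. g l)" for g :: "nat \<Rightarrow> 'a fls"
  proof -
    have "{..<n} = insert i (insert j ?R)"
      using ij by auto
    then have "(\<Sum>l<n. g l) = (\<Sum>l\<in>insert i (insert j ?R). g l)"
      by simp
    then show ?thesis
      using ij by (simp add: add.assoc)
  qed
  have "p k = (\<Sum>l<n. fls_const (a k l) * b l)"
    using assms(1) \<open>k < n\<close> by (simp add: expressed_by_def)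
  moreover have "fls_const (a k j + a k i * c) = fls_const (a k j) + fls_const (a k i) * fls_const c"
    by (simp add: fls_plus_const)
  ultimately show "p k = (\<Sum>l<n. fls_const (((a k)(j := a k j + a k i * c)) l)
      * (b(i := b i - fls_const c * b j)) l)"
    using ij unfolding split by (simp add: algebra_simps del: fls_const_mult_const)
qed

lemma wronskian_zero_member:
  fixes b :: "nat \<Rightarrow> 'a::field fls"
  assumes "j < n" "b j = 0"
  shows "wronskian n b = 0"
proof -
  let ?M = "mat n n (\<lambda>(k, j). (fls_deriv ^^ k) (b j))"
  have "(fls_deriv ^^ k) (0 :: 'a fls) = 0" for k
    by (induction k) simp_all
  then have "?M *\<^sub>v unit_vec n j = 0\<^sub>v n"
    using assms by (intro eq_vecI) (auto simp: row_def)
  moreover have "unit_vec n j \<noteq> (0\<^sub>v n :: 'a fls vec)"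
    using assms by (metis index_unit_vec(1) index_zero_vec(1) zero_neq_one)
  ultimately show ?thesis
    unfolding wronskian_def using det_0_iff_vec_prod_zero[of ?M n] by (metis mat_carrier unit_vec_carrier)
qed

section \<open>Families of least total width\<close>

definition low_exp :: "'a::zero fls \<Rightarrow> int" where
  "low_exp f = Min {i. fls_nth f i \<noteq> 0}"

definition high_exp :: "'a::zero fls \<Rightarrow> int" where
  "high_exp f = Max {i. fls_nth f i \<noteq> 0}"

definition width :: "'a::zero fls \<Rightarrow> nat" where
  "width f = nat (high_exp f - low_exp f)"

context
  fixes f :: "'a::zero fls"
  assumes f: "f \<in> laurent_polys" "f \<noteq> 0"
begin

lemma support_finite_nonempty: "finite {i. fls_nth f i \<noteq> 0}" "{i. fls_nth f i \<noteq> 0} \<noteq> {}"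
  using f by (auto simp: laurent_polys_def fls_nonzero_nth)

lemma low_exp_coeff: "fls_nth f (low_exp f) \<noteq> 0"
  and high_exp_coeff: "fls_nth f (high_exp f) \<noteq> 0"
  using Min_in[OF support_finite_nonempty] Max_in[OF support_finite_nonempty]
  by (simp_all add: low_exp_def high_exp_def)

lemma low_exp_le: "fls_nth f i \<noteq> 0 \<Longrightarrow> low_exp f \<le> i"
  and high_exp_ge: "fls_nth f i \<noteq> 0 \<Longrightarrow> i \<le> high_exp f"
  using support_finite_nonempty(1) by (simp_all add: low_exp_def high_exp_def)

lemma low_exp_le_high_exp: "low_exp f \<le> high_exp f"
  using high_exp_ge low_exp_coeff by blast

end

lemma laurent_polys_diff_const_mult:
  fixes f g :: "'a::comm_ring_1 fls"
  assumes "f \<in> laurent_polys" "g \<in> laurent_polys"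
  shows "f - fls_const c * g \<in> laurent_polys"
proof -
  have "{i. fls_nth (f - fls_const c * g) i \<noteq> 0} \<subseteq> {i. fls_nth f i \<noteq> 0} \<union> {i. fls_nth g i \<noteq> 0}"
    by auto
  then show ?thesis
    using assms unfolding laurent_polys_def by (auto intro: finite_subset)
qed

text \<open>
  If the exponent range of \<open>g\<close> lies in that of \<open>f\<close> and the two share an end \<open>m\<close>, cancelling the
  coefficient at \<open>m\<close> cuts off this end of \<open>f\<close> and adds no exponent outside its range.
\<close>

lemma width_cancel:
  fixes f g :: "'a::field fls"
  assumes f: "f \<in> laurent_polys" "f \<noteq> 0" and g: "g \<in> laurent_polys" "g \<noteq> 0"
    and le: "low_exp f \<le> low_exp g" "high_exp g \<le> high_exp f"
    and eq: "low_exp f = low_exp g \<or> high_exp f = high_exp g"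
  obtains c where "f - fls_const c * g = 0 \<or> width (f - fls_const c * g) < width f"
proof -
  obtain m where m: "m = low_exp f \<or> m = high_exp f" "fls_nth g m \<noteq> 0"
    using eq low_exp_coeff[OF g] high_exp_coeff[OF g] by metis
  define c where "c = fls_nth f m / fls_nth g m"
  define h where "h = f - fls_const c * g"
  have hm: "fls_nth h m = 0"
    using m(2) by (simp add: h_def c_def)
  have h: "h \<in> laurent_polys"
    unfolding h_def using f g by (intro laurent_polys_diff_const_mult)
  have range: "low_exp f \<le> i \<and> i \<le> high_exp f" if "fls_nth h i \<noteq> 0" for i
  proof -
    have "fls_nth f i \<noteq> 0 \<or> fls_nth g i \<noteq> 0"
      using that by (auto simp: h_def)
    then show ?thesis
      using low_exp_le[OF f, of i] high_exp_ge[OF f, of i] low_exp_le[OF g, of i]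
        high_exp_ge[OF g, of i] le by linarith
  qed
  have "width h < width f" if "h \<noteq> 0"
  proof -
    have "low_exp h \<noteq> m" "high_exp h \<noteq> m"
      using low_exp_coeff[OF h that] high_exp_coeff[OF h that] hm by auto
    then show ?thesis
      using range[OF low_exp_coeff[OF h that]] range[OF high_exp_coeff[OF h that]]
        low_exp_le_high_exp[OF h that] m(1) by (auto simp: width_def)
  qed
  then show thesis
    using that[of c] by (auto simp: h_def)
qed

text \<open>
  The family of least total width. If two members share an end, then the exponent range of one of
  them contains that of the other, and by the lemma above the larger one could be made narrower. The
  Wronskian being nonzero guarantees that no member of a family expressing \<open>p\<close> vanishes; so every
  member has a width.
\<close>

lemma ex_reduced_family:
  fixes p :: "nat \<Rightarrow> 'a::field fls"
  assumes p: "\<And>j. j < n \<Longrightarrow> p j \<in> laurent_polys" and W: "wronskian n p \<noteq> 0"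
  obtains a b where "expressed_by n a b p" "\<And>j. j < n \<Longrightarrow> b j \<in> laurent_polys"
    "\<And>j. j < n \<Longrightarrow> b j \<noteq> 0" "inj_on (low_exp \<circ> b) {..<n}" "inj_on (high_exp \<circ> b) {..<n}"
proof -
  define good where "good b \<longleftrightarrow> (\<exists>a. expressed_by n a b p) \<and> (\<forall>j<n. b j \<in> laurent_polys)" for b
  have "good p"
  proof -
    have "(\<Sum>j<n. fls_const (if i = j then 1 else 0) * p j) = p i" if "i < n" for i
    proof -
      have "(\<Sum>j<n. fls_const (if i = j then 1 else 0) * p j) = (\<Sum>j<n. if i = j then p j else 0)"
        by (rule sum.cong) auto
      then show ?thesis using that by simp
    qed
    then have "expressed_by n (\<lambda>i j. if i = j then 1 else 0) p p"
      by (simp add: expressed_by_def)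
    then show ?thesis
      using p unfolding good_def by blast
  qed
  then obtain b where b: "good b" "\<And>b'. good b' \<Longrightarrow> (\<Sum>j<n. width (b j)) \<le> (\<Sum>j<n. width (b' j))"
    using ex_has_least_nat[of good p "\<lambda>b. \<Sum>j<n. width (b j)"] by blast
  have nz: "b' j \<noteq> 0" if "good b'" "j < n" for b' j
    using that W wronskian_zero_member[of j n b'] wronskian_expressed_by unfolding good_def by fastforce
  have no_nested: "\<not> (low_exp (b i) \<le> low_exp (b j) \<and> high_exp (b j) \<le> high_exp (b i)
      \<and> (low_exp (b i) = low_exp (b j) \<or> high_exp (b i) = high_exp (b j)))"
    if ij: "i < n" "j < n" "i \<noteq> j" for i j
  proof
    assume nested: "low_exp (b i) \<le> low_exp (b j) \<and> high_exp (b j) \<le> high_exp (b i)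
      \<and> (low_exp (b i) = low_exp (b j) \<or> high_exp (b i) = high_exp (b j))"
    have "b i \<in> laurent_polys" "b i \<noteq> 0" "b j \<in> laurent_polys" "b j \<noteq> 0"
      using b(1) nz ij by (auto simp: good_def)
    from width_cancel[OF this] nested obtain c where
      c: "b i - fls_const c * b j = 0 \<or> width (b i - fls_const c * b j) < width (b i)"
      by blast
    define b' where "b' = b(i := b i - fls_const c * b j)"
    have "good b'"
      using b(1) expressed_by_update[OF _ ij] laurent_polys_diff_const_mult ij
      unfolding good_def b'_def by fastforce
    then have "width (b' i) < width (b i)"
      using c nz[of b' i] ij by (auto simp: b'_def)
    moreover have "b' l = b l" if "l \<noteq> i" for l
      using that by (simp add: b'_def)
    ultimately have "(\<Sum>l<n. width (b' l)) < (\<Sum>l<n. width (b l))"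
      using ij by (intro sum_strict_mono_ex1) (auto, metis less_imp_le order_refl)
    with b(2)[OF \<open>good b'\<close>] show False
      by simp
  qed
  \<comment> \<open>Of two members sharing one end, the one reaching further at the other end plays \<open>i\<close>.\<close>
  have "inj_on (low_exp \<circ> b) {..<n}" "inj_on (high_exp \<circ> b) {..<n}"
    unfolding inj_on_def using no_nested by (metis comp_apply lessThan_iff nle_le)+
  with that b(1) nz[OF b(1)] show thesis
    unfolding good_def by blast
qed

lemma laurent_monomial_of_low_eq_high:
  fixes f :: "'a::field fls"
  assumes "f \<in> laurent_polys" "f \<noteq> 0" "low_exp f = high_exp f"
  shows "f = fls_const (fls_nth f (low_exp f)) * fls_X_intpow (low_exp f)"
proof (rule fls_eqI)
  fix i
  have "fls_nth f i = 0" if "i \<noteq> low_exp f"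
    using low_exp_le[OF assms(1,2), of i] high_exp_ge[OF assms(1,2), of i] assms(3) that by force
  then show "fls_nth f i = fls_nth (fls_const (fls_nth f (low_exp f)) * fls_X_intpow (low_exp f)) i"
    by auto
qed

section \<open>Laurent polynomials with constant Wronskian\<close>

lemma invertible_mat_iff_det_nonzero:
  fixes A :: "'a::field mat"
  assumes A: "A \<in> carrier_mat n n"
  shows "invertible_mat A \<longleftrightarrow> det A \<noteq> 0"
proof
  assume "invertible_mat A"
  then obtain B where B: "A * B = 1\<^sub>m n" "B * A = 1\<^sub>m (dim_row B)"
    using A by (auto simp: invertible_mat_def inverts_mat_def)
  have "B \<in> carrier_mat n n"
    using A arg_cong[OF B(1), of dim_col] arg_cong[OF B(2), of dim_col] by auto
  then have "det A * det B = 1"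
    using B(1) det_mult[OF A] by (metis det_one)
  then show "det A \<noteq> 0" by auto
next
  assume "det A \<noteq> 0"
  from det_non_zero_imp_unit[OF A this, of "()"]
  obtain B where "B \<in> carrier_mat n n" "A * B = 1\<^sub>m n" "B * A = 1\<^sub>m n"
    by (auto simp: Units_def ring_mat_def)
  then show "invertible_mat A"
    using A by (auto simp: invertible_mat_def inverts_mat_def)
qed

lemma wronskian_monomials:
  fixes r :: "nat \<Rightarrow> int"
  assumes "inj_on r {..<n}" "(\<Sum>j<n. r j) = int (n choose 2)"
  obtains c :: "'a::field_char_0" where "c \<noteq> 0"
    "wronskian n (\<lambda>j. fls_X_intpow (r j)) = fls_const c"
proof -
  let ?W = "wronskian n (\<lambda>j. fls_X_intpow (r j)) :: 'a fls"
  \<comment> \<open>A monomial ends at its exponent on both sides, hence so does the Wronskian at \<open>0\<close>.\<close>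
  have supp: "supported_from s (r j) (fls_X_intpow (r j) :: 'a fls)" for s j
    by (auto simp: supported_from_def)
  have "supported_from 1 0 ?W" "supported_from (-1) 0 ?W" "fls_nth ?W 0 \<noteq> 0"
    using wronskian_edge[of 1 r n "\<lambda>j. fls_X_intpow (r j) :: 'a fls"]
      wronskian_edge[of "-1" r n "\<lambda>j. fls_X_intpow (r j) :: 'a fls"] assms supp by simp_all
  then have "i = 0" if "fls_nth ?W i \<noteq> 0" for i
    using that unfolding supported_from_def by force
  then have "?W = fls_const (fls_nth ?W 0)"
    by (intro fls_eqI) auto
  with \<open>fls_nth ?W 0 \<noteq> 0\<close> that show thesis
    by blast
qed

text \<open>
  For a reduced family \<open>b\<close> expressing \<open>p\<close>, the extreme coefficients of the Wronskian sit at
  \<open>\<Sum> low_exp - binom(n, 2)\<close> and \<open>\<Sum> high_exp - binom(n, 2)\<close>. Constancy makes both zero, so the termwise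
  inequality \<open>low_exp \<le> high_exp\<close> between equal sums is an equality throughout. The scalar factor of
  each monomial \<open>b j\<close> is absorbed into the coefficients \<open>a\<close>.
\<close>

lemma constant_wronskian_imp_monomials:
  fixes p :: "nat \<Rightarrow> 'a::field_char_0 fls"
  assumes p: "\<And>j. j < n \<Longrightarrow> p j \<in> laurent_polys"
    and W: "wronskian n p = fls_const c" "c \<noteq> 0"
  obtains a r where "inj_on r {..<n}" "(\<Sum>j<n. r j) = int (n choose 2)"
    "expressed_by n a (\<lambda>j. fls_X_intpow (r j)) p"
proof -
  have "wronskian n p \<noteq> 0"
    using W by simp
  from ex_reduced_family[OF p this] obtain a b where
    ab: "expressed_by n a b p" and b: "\<And>j. j < n \<Longrightarrow> b j \<in> laurent_polys" "\<And>j. j < n \<Longrightarrow> b j \<noteq> 0"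
    and inj: "inj_on (low_exp \<circ> b) {..<n}" "inj_on (high_exp \<circ> b) {..<n}"
    by blast
  have const: "i = 0" if "fls_nth (wronskian n b) i \<noteq> 0" for i
  proof (rule ccontr)
    assume "i \<noteq> 0"
    let ?d = "det (mat n n (\<lambda>(i, j). a i j))"
    have eq: "fls_const ?d * wronskian n b = fls_const c"
      using wronskian_expressed_by[OF ab] W by simp
    then have "?d \<noteq> 0"
      using \<open>c \<noteq> 0\<close> by (metis fls_const_0 fls_const_nonzero mult_zero_left)
    moreover have "?d * fls_nth (wronskian n b) i = 0"
      using arg_cong[OF eq, of "\<lambda>f. fls_nth f i"] \<open>i \<noteq> 0\<close> by simp
    ultimately show False
      using that by simp
  qed
  have "supported_from 1 (low_exp (b j)) (b j)" "supported_from (-1) (high_exp (b j)) (b j)"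
    if "j < n" for j
    using low_exp_le[OF b(1,2)[OF that]] high_exp_ge[OF b(1,2)[OF that]]
    by (auto simp: supported_from_def)
  then have "(\<Sum>j<n. low_exp (b j)) = int (n choose 2)" "(\<Sum>j<n. high_exp (b j)) = int (n choose 2)"
    using wronskian_edge(2)[of 1 "low_exp \<circ> b" n b, THEN const]
      wronskian_edge(2)[of "-1" "high_exp \<circ> b" n b, THEN const]
      inj low_exp_coeff[OF b] high_exp_coeff[OF b] by simp_all
  note sums = this
  have le: "low_exp (b j) \<le> high_exp (b j)" if "j < n" for j
    using low_exp_le_high_exp[OF b[OF that]] .
  have eq: "low_exp (b j) = high_exp (b j)" if "j < n" for j
    using sum_mono_inv[of "low_exp \<circ> b" "{..<n}" "high_exp \<circ> b" j] sums le that by simp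
  have "fls_const (a i j) * b j
      = fls_const (a i j * fls_nth (b j) (low_exp (b j))) * fls_X_intpow (low_exp (b j))" if "j < n" for i j
    using arg_cong[OF laurent_monomial_of_low_eq_high[OF b[OF that] eq[OF that]], of "(*) (fls_const (a i j))"]
    by (simp add: mult.assoc flip: fls_const_mult_const)
  then have "expressed_by n (\<lambda>i j. a i j * fls_nth (b j) (low_exp (b j)))
      (\<lambda>j. fls_X_intpow ((low_exp \<circ> b) j)) p"
    using ab by (simp add: expressed_by_def del: fls_const_mult_const)
  with that[of "low_exp \<circ> b"] inj(1) sums(1) show thesis
    by simp
qed

theorem theorem18:
  fixes n :: nat and p :: "nat \<Rightarrow> 'a::field_char_0 fls"
  assumes "n > 0"
    and "\<And>j. j < n \<Longrightarrow> p j \<in> laurent_polys"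
    and "lin_indep_family n p"
  shows "(\<exists>c :: 'a. c \<noteq> 0 \<and> wronskian n p = fls_const c) \<longleftrightarrow>
    (\<exists>(A :: 'a mat) (r :: nat \<Rightarrow> int).
        A \<in> carrier_mat n n \<and> invertible_mat A \<and>
        inj_on r {..<n} \<and> (\<Sum>j<n. r j) = int (n choose 2) \<and>
        vec n p = map_mat fls_const A *\<^sub>v vec n (\<lambda>j. fls_X_intpow (r j)))"
    (is "?constant \<longleftrightarrow> ?monomial")
proof
  assume ?constant
  then obtain c where c: "wronskian n p = fls_const c" "c \<noteq> 0"
    by blast
  obtain a r where r: "inj_on r {..<n}" "(\<Sum>j<n. r j) = int (n choose 2)"
    and a: "expressed_by n a (\<lambda>j. fls_X_intpow (r j)) p"
    using constant_wronskian_imp_monomials[OF assms(2) c] by blast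
  define A where "A = mat n n (\<lambda>(i, j). a i j)"
  have A: "A \<in> carrier_mat n n"
    by (simp add: A_def)
  have "det A \<noteq> 0"
    using wronskian_expressed_by[OF a] c by (auto simp: A_def)
  then have "invertible_mat A"
    using invertible_mat_iff_det_nonzero[OF A] by blast
  moreover have "vec n p = map_mat fls_const A *\<^sub>v vec n (\<lambda>j. fls_X_intpow (r j))"
    unfolding vec_eq_mult_mat_iff_expressed_by[OF A]
    using a by (simp add: A_def expressed_by_def)
  ultimately show ?monomial
    using A r by blast
next
  assume ?monomial
  then obtain A r where A: "A \<in> carrier_mat n n" "invertible_mat A"
    and r: "inj_on r {..<n}" "(\<Sum>j<n. r j) = int (n choose 2)"
    and "vec n p = map_mat fls_const A *\<^sub>v vec n (\<lambda>j. fls_X_intpow (r j))"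
    by blast
  then have "expressed_by n (\<lambda>i j. A $$ (i, j)) (\<lambda>j. fls_X_intpow (r j)) p"
    using vec_eq_mult_mat_iff_expressed_by[OF A(1)] by blast
  moreover have "mat n n (\<lambda>(i, j). A $$ (i, j)) = A"
    using A(1) by auto
  ultimately have W: "wronskian n p = fls_const (det A) * wronskian n (\<lambda>j. fls_X_intpow (r j))"
    using wronskian_expressed_by by metis
  obtain c :: 'a where c: "c \<noteq> 0" "wronskian n (\<lambda>j. fls_X_intpow (r j)) = fls_const c"
    using wronskian_monomials[OF r] by blast
  have "det A \<noteq> 0"
    using A invertible_mat_iff_det_nonzero by blast
  with W c show ?constant
    by (intro exI[of _ "det A * c"]) simp
qed

end
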